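(* For every $\kappa<1$, there exists a hypothesis class of submodular functions with curvature $\kappa$ whose Shapley value is not $(\sqrt{1-\kappa}+\epsilon)$-approximable from samples over the uniform distribution on $2^N$, for every constant $\epsilon>0$.
   Context: $N=\{1,\dots,n\}$, cost functions $C:2^N\to\mathbb{R}_{\ge0}$ with $C(\emptyset)=0$; $C_S(i)=C(S\cup\{i\})-C(S)$. $C$ is submodular if $C_S(i)\ge C_T(i)$ for $S\subseteq T$, $i\notin T$. A monotone submodular $C$ has curvature $\kappa\in[0,1]$ if $C_{N\setminus\{i\}}(i)\ge(1-\kappa)C(\{i\})$ for all $i$. The Shapley value is $\phi_i=\mathbb{E}_\sigma[C(S_{\sigma<i}\cup\{i\})-C(S_{\sigma<i})]$ for a uniformly random permutation $\sigma$, $S_{\sigma<i}$ the players before $i$. An algorithm $\alpha$-approximates ($\alpha\in(0,1]$) the Shapley value of a family $\mathcal{C}$ over $\mathcal{D}$ if for all $C\in\mathcal{C}$ and $\delta>0$, given $\mathrm{poly}(n,1/\delta,1/(1-\alpha))$ i.i.d. samples $(S,C(S))$, $S\sim\mathcal{D}$, it computes $\tilde\phi$ such that with probability at least $1-\delta$ over samples and its choices, for all $i$: if $\phi_i\ge1/\mathrm{poly}(n)$ then $\alpha\phi_i\le\tilde\phi_i\le\phi_i/\alpha$; if $\phi_i\le-1/\mathrm{poly}(n)$ then $\phi_i/\alpha\le\tilde\phi_i\le\alpha\phi_i$; if $|\phi_i|<1/\mathrm{poly}(n)$ then $|\phi_i-\tilde\phi_i|=o(1)$. The Shapley value of $\mathcal{C}$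 is $\alpha$-approximable from samples over $\mathcal{D}$ if such an algorithm exists. *)

theory Defs
  imports "HOL-Probability.Probability" "HOL-Combinatorics.Multiset_Permutations"
begin

text \<open>Players are N = {1..n}; a cost function is a map C :: nat set => real, of which
only the values on subsets of {1..n} are relevant.\<close>

definition players :: "nat \<Rightarrow> nat set" where
  "players n = {1..n}"

definition marginal :: "(nat set \<Rightarrow> real) \<Rightarrow> nat set \<Rightarrow> nat \<Rightarrow> real" where
  "marginal C S i = C (S \<union> {i}) - C S"

definition cost_function :: "nat \<Rightarrow> (nat set \<Rightarrow> real) \<Rightarrow> bool" where
  "cost_function n C \<longleftrightarrow> C {} = 0 \<and> (\<forall>S. S \<subseteq> players n \<longrightarrow> C S \<ge> 0)"

definition monotone_cost :: "nat \<Rightarrow> (nat set \<Rightarrow> real) \<Rightarrow> bool" where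
  "monotone_cost n C \<longleftrightarrow> (\<forall>S T. S \<subseteq> T \<and> T \<subseteq> players n \<longrightarrow> C S \<le> C T)"

definition submodular :: "nat \<Rightarrow> (nat set \<Rightarrow> real) \<Rightarrow> bool" where
  "submodular n C \<longleftrightarrow> (\<forall>S T i. S \<subseteq> T \<and> T \<subseteq> players n \<and> i \<in> players n - T
       \<longrightarrow> marginal C S i \<ge> marginal C T i)"

definition has_curvature :: "nat \<Rightarrow> real \<Rightarrow> (nat set \<Rightarrow> real) \<Rightarrow> bool" where
  "has_curvature n \<kappa> C \<longleftrightarrow> 0 \<le> \<kappa> \<and> \<kappa> \<le> 1 \<and>
     (\<forall>i \<in> players n. marginal C (players n - {i}) i \<ge> (1 - \<kappa>) * C {i})"

definition shapley :: "nat \<Rightarrow> (nat set \<Rightarrow> real) \<Rightarrow> nat \<Rightarrow> real" where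
  "shapley n C i = measure_pmf.expectation (pmf_of_set (permutations_of_set (players n)))
      (\<lambda>\<sigma>. marginal C (set (takeWhile (\<lambda>j. j \<noteq> i) \<sigma>)) i)"

definition uniform_subsets :: "nat \<Rightarrow> nat set pmf" where
  "uniform_subsets n = pmf_of_set (Pow (players n))"

definition labelled_samples :: "nat \<Rightarrow> nat \<Rightarrow> (nat set \<Rightarrow> real) \<Rightarrow> (nat set \<times> real) list pmf" where
  "labelled_samples n m C = map_pmf (map (\<lambda>S. (S, C S))) (replicate_pmf m (uniform_subsets n))"

definition good_estimate :: "nat \<Rightarrow> real \<Rightarrow> real \<Rightarrow> real \<Rightarrow> (nat set \<Rightarrow> real) \<Rightarrow> (nat \<Rightarrow> real) \<Rightarrow> bool" where
  "good_estimate n \<alpha> t g C est \<longleftrightarrow> (\<forall>i \<in> players n.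
      (shapley n C i \<ge> t \<longrightarrow> \<alpha> * shapley n C i \<le> est i \<and> est i \<le> shapley n C i / \<alpha>) \<and>
      (shapley n C i \<le> - t \<longrightarrow> shapley n C i / \<alpha> \<le> est i \<and> est i \<le> \<alpha> * shapley n C i) \<and>
      (\<bar>shapley n C i\<bar> < t \<longrightarrow> \<bar>shapley n C i - est i\<bar> \<le> g))"

text \<open>A (randomized) algorithm gets n, delta and the list of labelled samples and returns a
distribution over estimate vectors.  The number of samples m n delta is polynomial in
n, 1/delta and 1/(1-alpha).\<close>

definition shapley_approximable :: "real \<Rightarrow> (nat \<Rightarrow> (nat set \<Rightarrow> real) set) \<Rightarrow> bool" where
  "shapley_approximable \<alpha> \<C> \<longleftrightarrow> 0 < \<alpha> \<and> \<alpha> \<le> 1 \<and>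
    (\<exists>(A :: nat \<Rightarrow> real \<Rightarrow> (nat set \<times> real) list \<Rightarrow> (nat \<Rightarrow> real) pmf)
       (m :: nat \<Rightarrow> real \<Rightarrow> nat) (t :: nat \<Rightarrow> real) (g :: nat \<Rightarrow> real).
       (\<exists>c (k::nat). \<forall>n \<delta>. 0 < \<delta> \<longrightarrow>
            real (m n \<delta>) \<le> c * (real n + 1 / \<delta> + 1 / (1 - \<alpha>) + 1) ^ k) \<and>
       (\<forall>n. 0 < t n \<and> t n \<le> 1) \<and>
       (\<exists>c (k::nat). \<forall>n. 1 / t n \<le> c * (real n + 1) ^ k) \<and>
       g \<longlonglongrightarrow> 0 \<and>
       (\<forall>n. \<forall>C \<in> \<C> n. \<forall>\<delta> > 0.
          measure_pmf.prob (labelled_samples n (m n \<delta>) C \<bind> A n \<delta>)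
             {est. good_estimate n \<alpha> (t n) (g n) C est} \<ge> 1 - \<delta>))"

end

theory Submission
  imports Defs "HOL-Real_Asymp.Real_Asymp"
begin

text \<open>Let \<open>r = 1 / (1 - \<kappa>)\<close>. The marginal of a player from a group \<open>A\<close> of size \<open>k\<close> drops from
  \<open>r\<^sup>2\<close> to \<open>r\<close> just before half of \<open>A\<close> is present; the marginal of a player from a disjoint
  group \<open>B\<close> of size \<open>k\<close> drops from \<open>r\<close> to \<open>1\<close> just after half of \<open>B\<close> is present. A random
  coalition contains about half of each group, and there the cost is \<open>r * |S|\<close> plus a constant,
  so a polynomial number of samples does not reveal which group is which. The Shapley
  values of the two groups, however, differ by a factor tending to \<open>r\<close>, so an estimate that is
  correct for both roles of \<open>A\<close> has \<open>\<alpha>\<^sup>2 \<le> 1 / r\<close> in the limit.\<close>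

section \<open>Costs depending on the size of one group\<close>

text \<open>A piecewise linear function of the group size, with slope \<open>p + q\<close> up to
  \<open>l\<close> and \<open>p\<close> beyond. The cap is real so that values such as
  \<open>(1 - \<eta>) * k / 2\<close> need no rounding.\<close>

definition capped_card :: "real \<Rightarrow> real \<Rightarrow> real \<Rightarrow> nat set \<Rightarrow> nat set \<Rightarrow> real" where
  "capped_card p q l A S = p * real (card (S \<inter> A)) + q * min (real (card (S \<inter> A))) l"

lemma marginal_capped_card_in:
  assumes "i \<in> A" "i \<notin> S" "finite S"
  shows "marginal (capped_card p q l A) S i =
           p + q * (min (real (card (S \<inter> A)) + 1) l - min (real (card (S \<inter> A))) l)"
proof -
  have "(S \<union> {i}) \<inter> A = insert i (S \<inter> A)" using assms by auto
  then have "card ((S \<union> {i}) \<inter> A) = Suc (card (S \<inter> A))" using assms by simp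
  then show ?thesis
    by (simp add: marginal_def capped_card_def algebra_simps)
qed

lemma marginal_capped_card_notin:
  "i \<notin> A \<Longrightarrow> marginal (capped_card p q l A) S i = 0"
proof -
  assume "i \<notin> A"
  then have "(S \<union> {i}) \<inter> A = S \<inter> A" by auto
  then show ?thesis by (simp add: marginal_def capped_card_def)
qed

text \<open>One more member raises the capped count by between 0 and 1. The bounds serve both the
  curvature and the lower bound on Shapley values.\<close>

lemma marginal_capped_card_bounds:
  assumes "i \<in> A" "i \<notin> S" "finite S" "0 \<le> q"
  shows "p \<le> marginal (capped_card p q l A) S i" "marginal (capped_card p q l A) S i \<le> p + q"
proof -
  let ?c = "min (real (card (S \<inter> A)) + 1) l - min (real (card (S \<inter> A))) l"
  have "0 \<le> ?c" "?c \<le> 1" by (auto simp: min_def)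
  then have "0 \<le> q * ?c" "q * ?c \<le> q * 1"
    using assms by (auto intro: mult_left_mono mult_nonneg_nonneg simp del: mult_1_right)
  then show "p \<le> marginal (capped_card p q l A) S i" "marginal (capped_card p q l A) S i \<le> p + q"
    using marginal_capped_card_in[OF assms(1-3), of p q l] by auto
qed

text \<open>\<open>min x l\<close> is concave in \<open>x\<close>, so its unit increments shrink as
  the count grows.\<close>

lemma marginal_capped_card_antimono:
  assumes "S \<subseteq> T" "finite T" "i \<notin> T" "0 \<le> q"
  shows "marginal (capped_card p q l A) T i \<le> marginal (capped_card p q l A) S i"
proof (cases "i \<in> A")
  case True
  have "card (S \<inter> A) \<le> card (T \<inter> A)" using assms by (intro card_mono) auto
  then have "real (card (S \<inter> A)) \<le> real (card (T \<inter> A))" by simp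
  then have "min (real (card (T \<inter> A)) + 1) l - min (real (card (T \<inter> A))) l
      \<le> min (real (card (S \<inter> A)) + 1) l - min (real (card (S \<inter> A))) l"
    by (auto simp: min_def)
  moreover have "i \<notin> S" "finite S" using assms finite_subset by auto
  ultimately show ?thesis
    using True assms by (simp add: marginal_capped_card_in mult_left_mono)
qed (simp add: marginal_capped_card_notin)

lemma capped_card_mono:
  assumes "S \<subseteq> T" "finite T" "0 \<le> p" "0 \<le> q"
  shows "capped_card p q l A S \<le> capped_card p q l A T"
proof -
  have "card (S \<inter> A) \<le> card (T \<inter> A)" using assms by (intro card_mono) auto
  then have "real (card (S \<inter> A)) \<le> real (card (T \<inter> A))" by simp
  then show ?thesis unfolding capped_card_def
    using assms by (intro add_mono mult_left_mono) (auto simp: min_def)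
qed

lemma capped_card_nonneg:
  "\<lbrakk>0 \<le> p; 0 \<le> q; 0 \<le> l\<rbrakk> \<Longrightarrow> 0 \<le> capped_card p q l A S"
  by (simp add: capped_card_def)

lemma capped_card_empty: "0 \<le> l \<Longrightarrow> capped_card p q l A {} = 0"
  by (simp add: capped_card_def)

section \<open>The two-group cost function\<close>

text \<open>The slopes are \<open>r * r\<close> and then \<open>r\<close> on \<open>A\<close>, but
  \<open>r\<close> and then \<open>1\<close> on \<open>B\<close>: both drop by the factor
  \<open>r\<close>, and the low slope of \<open>A\<close> is the high slope of
  \<open>B\<close>.\<close>

definition two_group_cost ::
    "real \<Rightarrow> real \<Rightarrow> real \<Rightarrow> nat set \<Rightarrow> nat set \<Rightarrow> nat set \<Rightarrow> real" where
  "two_group_cost r l h A B S = capped_card r (r * (r - 1)) l A S + capped_card 1 (r - 1) h B S"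

lemma marginal_two_group_cost:
  "marginal (two_group_cost r l h A B) S i =
     marginal (capped_card r (r * (r - 1)) l A) S i + marginal (capped_card 1 (r - 1) h B) S i"
  by (simp add: marginal_def two_group_cost_def)

lemma finite_players [simp]: "finite (players n)"
  by (simp add: players_def)

lemma cost_function_two_group_cost:
  assumes "1 \<le> r" "0 \<le> l" "0 \<le> h"
  shows "cost_function n (two_group_cost r l h A B)"
  using assms by (simp add: cost_function_def two_group_cost_def capped_card_nonneg capped_card_empty)

lemma monotone_two_group_cost:
  assumes "1 \<le> r"
  shows "monotone_cost n (two_group_cost r l h A B)"
  unfolding monotone_cost_def two_group_cost_def
  using assms by (auto intro!: add_mono capped_card_mono intro: finite_subset[OF _ finite_players])

lemma submodular_two_group_cost:
  assumes "1 \<le> r"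
  shows "submodular n (two_group_cost r l h A B)"
  unfolding submodular_def marginal_two_group_cost
  using assms
  by (auto intro!: add_mono marginal_capped_card_antimono intro: finite_subset[OF _ finite_players])

text \<open>Within a group the marginals vary by a factor of at most \<open>r\<close>, which is what
  curvature \<open>\<kappa>\<close> permits; players outside both groups always have marginal
  0.\<close>

lemma curvature_two_group_cost:
  assumes "0 \<le> \<kappa>" "\<kappa> < 1" and r: "r = 1 / (1 - \<kappa>)" and "0 \<le> l" "0 \<le> h" "A \<inter> B = {}"
  shows "has_curvature n \<kappa> (two_group_cost r l h A B)"
  unfolding has_curvature_def
proof (intro conjI ballI)
  fix i assume "i \<in> players n"
  have r1: "1 \<le> r" and kr: "(1 - \<kappa>) * r = 1" using assms by (auto simp: le_divide_eq_1)
  let ?C = "two_group_cost r l h A B" and ?N = "players n - {i}"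
  have emp: "?C {i} = marginal ?C {} i"
    using assms by (simp add: marginal_def two_group_cost_def capped_card_empty)
  consider "i \<in> A" "i \<notin> B" | "i \<in> B" "i \<notin> A" | "i \<notin> A" "i \<notin> B"
    using assms by auto
  then show "(1 - \<kappa>) * ?C {i} \<le> marginal ?C ?N i"
  proof cases
    case 1
    have "?C {i} \<le> r + r * (r - 1)"
      unfolding emp marginal_two_group_cost
      using 1 r1 marginal_capped_card_bounds(2)[of i A "{}" "r * (r - 1)" r l]
      by (simp add: marginal_capped_card_notin)
    then have "(1 - \<kappa>) * ?C {i} \<le> (1 - \<kappa>) * (r + r * (r - 1))"
      using assms by (intro mult_left_mono) auto
    also have "\<dots> = (1 - \<kappa>) * r * r" by (simp add: algebra_simps)
    also have "\<dots> = r" by (simp add: kr)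
    also have "\<dots> \<le> marginal ?C ?N i"
      unfolding marginal_two_group_cost
      using 1 r1 marginal_capped_card_bounds(1)[of i A ?N "r * (r - 1)" r l]
      by (simp add: marginal_capped_card_notin)
    finally show ?thesis .
  next
    case 2
    have "?C {i} \<le> r"
      unfolding emp marginal_two_group_cost
      using 2 r1 marginal_capped_card_bounds(2)[of i B "{}" "r - 1" 1 h]
      by (simp add: marginal_capped_card_notin)
    then have "(1 - \<kappa>) * ?C {i} \<le> (1 - \<kappa>) * r"
      using assms by (intro mult_left_mono) auto
    also have "\<dots> = 1" by (rule kr)
    also have "\<dots> \<le> marginal ?C ?N i"
      unfolding marginal_two_group_cost
      using 2 r1 marginal_capped_card_bounds(1)[of i B ?N "r - 1" 1 h]
      by (simp add: marginal_capped_card_notin)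
    finally show ?thesis .
  next
    case 3
    then show ?thesis by (simp add: emp marginal_two_group_cost marginal_capped_card_notin)
  qed
qed (use assms in auto)

text \<open>In this window the cap \<open>l\<close> is used up and the cap \<open>h\<close> is not
  yet active, so both sides equal \<open>r * (card (S \<inter> A) + card (S \<inter> B)) + r * (r -
  1) * l\<close>.\<close>

lemma two_group_cost_swap:
  assumes "real (card (S \<inter> A)) \<in> {l..h}" "real (card (S \<inter> B)) \<in> {l..h}"
  shows "two_group_cost r l h A B S = two_group_cost r l h B A S"
  using assms by (simp add: two_group_cost_def capped_card_def min_absorb1 min_absorb2 algebra_simps)

section \<open>Shapley values: efficiency and group totals\<close>

lemma shapley_eq_avg:
  "shapley n C i = (\<Sum>\<sigma>\<in>permutations_of_set (players n).
      marginal C (set (takeWhile (\<lambda>j. j \<noteq> i) \<sigma>)) i) / card (permutations_of_set (players n))"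
  unfolding shapley_def by (subst integral_pmf_of_set) auto

text \<open>Each term is the increase in cost when a player joins its predecessors, so the sum
  telescopes.\<close>

lemma sum_marginal_takeWhile:
  "distinct \<sigma> \<Longrightarrow>
     (\<Sum>i\<in>set \<sigma>. marginal C (set (takeWhile (\<lambda>j. j \<noteq> i) \<sigma>)) i) = C (set \<sigma>) - C {}"
proof (induction \<sigma> rule: rev_induct)
  case (snoc x xs)
  \<comment> \<open>For players of \<open>xs\<close>, \<open>takeWhile\<close> stops before the
    appended \<open>x\<close> is reached; \<open>x\<close> itself contributes the last
    increment.\<close>
  have "(\<Sum>i\<in>set xs. marginal C (set (takeWhile (\<lambda>j. j \<noteq> i) (xs @ [x]))) i)
      = (\<Sum>i\<in>set xs. marginal C (set (takeWhile (\<lambda>j. j \<noteq> i) xs)) i)"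
    by (intro sum.cong refl) (simp add: takeWhile_append1)
  moreover have "takeWhile (\<lambda>j. j \<noteq> x) (xs @ [x]) = xs"
    using snoc.prems by (subst takeWhile_append2) auto
  ultimately show ?case using snoc by (simp add: marginal_def)
qed simp

text \<open>After exchanging the two sums, every permutation contributes the same telescoped
  total.\<close>

lemma shapley_efficient: "(\<Sum>i\<in>players n. shapley n C i) = C (players n) - C {}"
proof -
  let ?P = "permutations_of_set (players n)"
  have "(\<Sum>i\<in>players n. shapley n C i) = (\<Sum>\<sigma>\<in>?P. \<Sum>i\<in>players n.
      marginal C (set (takeWhile (\<lambda>j. j \<noteq> i) \<sigma>)) i) / card ?P"
    unfolding shapley_eq_avg by (subst sum.swap) (simp add: sum_divide_distrib)
  also have "(\<Sum>\<sigma>\<in>?P. \<Sum>i\<in>players n. marginal C (set (takeWhile (\<lambda>j. j \<noteq> i) \<sigma>)) i)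
      = (\<Sum>\<sigma>\<in>?P. C (players n) - C {})"
  proof (intro sum.cong refl)
    fix \<sigma> assume "\<sigma> \<in> ?P"
    then have "set \<sigma> = players n" "distinct \<sigma>" by (auto dest: permutations_of_setD)
    then show "(\<Sum>i\<in>players n. marginal C (set (takeWhile (\<lambda>j. j \<noteq> i) \<sigma>)) i) = C (players n) - C {}"
      using sum_marginal_takeWhile[of \<sigma> C] by simp
  qed
  finally show ?thesis by simp
qed

lemma shapley_ge:
  assumes "\<And>S. finite S \<Longrightarrow> i \<notin> S \<Longrightarrow> c \<le> marginal C S i"
  shows "c \<le> shapley n C i"
proof -
  let ?P = "permutations_of_set (players n)"
  \<comment> \<open>The prefix before \<open>i\<close> never contains \<open>i\<close>, so the
    assumed bound applies to every permutation.\<close>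
  have "(\<Sum>\<sigma>\<in>?P. c) \<le> (\<Sum>\<sigma>\<in>?P. marginal C (set (takeWhile (\<lambda>j. j \<noteq> i) \<sigma>)) i)"
    by (intro sum_mono assms) (auto dest: set_takeWhileD)
  moreover have "0 < card ?P" by (simp add: card_gt_0_iff)
  ultimately show ?thesis
    unfolding shapley_eq_avg by (simp add: field_simps)
qed

text \<open>Yields group totals without computing individual values. Shapley values depend only on
  marginals, so on \<open>A\<close> the game may be replaced by the capped cost; there everyone
  outside \<open>A\<close> gets 0, and efficiency gives the total.\<close>

lemma sum_shapley_capped_card:
  assumes "A \<subseteq> players n" "0 \<le> l"
    and C: "\<And>S i. i \<in> A \<Longrightarrow> marginal C S i = marginal (capped_card p q l A) S i"
  shows "(\<Sum>i\<in>A. shapley n C i) = p * real (card A) + q * min (real (card A)) l"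
proof -
  let ?G = "capped_card p q l A"
  have "(\<Sum>i\<in>A. shapley n C i) = (\<Sum>i\<in>A. shapley n ?G i)"
    by (intro sum.cong refl) (simp add: shapley_def C)
  also have "\<dots> = (\<Sum>i\<in>players n. shapley n ?G i)"
    using assms(1)
    by (intro sum.mono_neutral_left) (auto simp: shapley_def marginal_capped_card_notin)
  also have "\<dots> = p * real (card A) + q * min (real (card A)) l"
    using assms(1,2) by (simp add: shapley_efficient capped_card_empty)
      (simp add: capped_card_def Int_absorb1)
  finally show ?thesis .
qed

lemma sum_shapley_two_group_cost:
  assumes "A \<subseteq> players n" "B \<subseteq> players n" "A \<inter> B = {}" "0 \<le> l" "0 \<le> h"
  shows "(\<Sum>i\<in>A. shapley n (two_group_cost r l h A B) i) = r * real (card A) + r * (r - 1) * min (real (card A)) l"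
    and "(\<Sum>i\<in>B. shapley n (two_group_cost r l h A B) i) = real (card B) + (r - 1) * min (real (card B)) h"
proof -
  show "(\<Sum>i\<in>A. shapley n (two_group_cost r l h A B) i) = r * real (card A) + r * (r - 1) * min (real (card A)) l"
    using assms
    by (intro sum_shapley_capped_card) (auto simp: marginal_two_group_cost intro!: marginal_capped_card_notin)
  have "(\<Sum>i\<in>B. shapley n (two_group_cost r l h A B) i) = 1 * real (card B) + (r - 1) * min (real (card B)) h"
    using assms
    by (intro sum_shapley_capped_card) (auto simp: marginal_two_group_cost intro!: marginal_capped_card_notin)
  then show "(\<Sum>i\<in>B. shapley n (two_group_cost r l h A B) i) = real (card B) + (r - 1) * min (real (card B)) h"
    by simp
qed

text \<open>Even the smallest slope is at least 1. Hence, for a threshold of at most 1, these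
  players fall under the multiplicative clause of \<open>good_estimate\<close>.\<close>

lemma shapley_two_group_cost_ge_1:
  assumes "A \<inter> B = {}" "1 \<le> r" "i \<in> A \<union> B"
  shows "1 \<le> shapley n (two_group_cost r l h A B) i"
proof (rule shapley_ge)
  fix S :: "nat set" assume S: "finite S" "i \<notin> S"
  consider "i \<in> A" "i \<notin> B" | "i \<in> B" "i \<notin> A" using assms by auto
  then show "1 \<le> marginal (two_group_cost r l h A B) S i"
  proof cases
    case 1
    then show ?thesis
      using assms S marginal_capped_card_bounds(1)[of i A S "r * (r - 1)" r l]
      by (simp add: marginal_two_group_cost marginal_capped_card_notin)
  next
    case 2
    then show ?thesis
      using assms S marginal_capped_card_bounds(1)[of i B S "r - 1" 1 h]
      by (simp add: marginal_two_group_cost marginal_capped_card_notin)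
  qed
qed

section \<open>Sampling: coupling, union bound and concentration\<close>

text \<open>Where \<open>F\<close> and \<open>G\<close> agree, so do the conditional probabilities
  of \<open>E\<close>; elsewhere they differ by at most 1.\<close>

lemma measure_bind_pmf_le:
  "measure_pmf.prob (p \<bind> F) E \<le> measure_pmf.prob (p \<bind> G) E + measure_pmf.prob p {x. F x \<noteq> G x}"
proof -
  have "emeasure (measure_pmf (p \<bind> F)) E = (\<integral>\<^sup>+x. emeasure (F x) E \<partial>p)"
    by (simp add: emeasure_bind_pmf)
  also have "\<dots> \<le> (\<integral>\<^sup>+x. (emeasure (G x) E + indicator {x. F x \<noteq> G x} x) \<partial>p)"
    by (intro nn_integral_mono) (auto split: split_indicator intro: order_trans[OF measure_pmf.emeasure_le_1])
  also have "\<dots> = emeasure (measure_pmf (p \<bind> G)) E + emeasure (measure_pmf p) {x. F x \<noteq> G x}"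
    by (subst nn_integral_add) (auto simp: emeasure_bind_pmf)
  finally show ?thesis
    by (simp add: measure_pmf.emeasure_eq_measure flip: ennreal_plus)
qed

text \<open>A union bound over independent draws, by splitting off the first one.\<close>

lemma measure_replicate_pmf_le:
  "measure_pmf.prob (replicate_pmf m p) {xs. \<exists>x\<in>set xs. x \<in> X} \<le> m * measure_pmf.prob p X"
proof (induction m)
  case (Suc m)
  let ?E = "\<lambda>xs. \<exists>x\<in>set xs. x \<in> X"
  have prob_fst: "measure_pmf.prob (pair_pmf p (replicate_pmf m p)) (fst -` Y) = measure_pmf.prob p Y" for Y
    unfolding measure_map_pmf[symmetric] map_fst_pair_pmf ..
  have prob_snd: "measure_pmf.prob (pair_pmf p (replicate_pmf m p)) (snd -` Y)
      = measure_pmf.prob (replicate_pmf m p) Y" for Y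
    unfolding measure_map_pmf[symmetric] map_snd_pair_pmf ..
  have eq: "replicate_pmf (Suc m) p = map_pmf (\<lambda>(x, xs). x # xs) (pair_pmf p (replicate_pmf m p))"
    by (simp add: pair_pmf_def map_bind_pmf bind_return_pmf bind_assoc_pmf map_pmf_def)
  have "measure_pmf.prob (replicate_pmf (Suc m) p) {xs. ?E xs}
      = measure_pmf.prob (pair_pmf p (replicate_pmf m p)) (fst -` X \<union> snd -` {xs. ?E xs})"
    unfolding eq measure_map_pmf by (intro arg_cong[where f = "measure_pmf.prob _"]) auto
  also have "\<dots> \<le> measure_pmf.prob (pair_pmf p (replicate_pmf m p)) (fst -` X)
      + measure_pmf.prob (pair_pmf p (replicate_pmf m p)) (snd -` {xs. ?E xs})"
    by (intro measure_Un_le) auto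
  also have "\<dots> = measure_pmf.prob p X + measure_pmf.prob (replicate_pmf m p) {xs. ?E xs}"
    by (simp only: prob_fst prob_snd)
  finally show ?case using Suc by (simp add: algebra_simps)
qed simp


text \<open>A uniform subset is given by independent fair coins, one per element; only the coins of
  \<open>A\<close> matter for the count.\<close>

lemma card_Int_uniform_subset:
  assumes "finite N" "A \<subseteq> N"
  shows "map_pmf (\<lambda>S. card (S \<inter> A)) (pmf_of_set (Pow N)) = binomial_pmf (card A) (1/2)"
proof -
  have "finite A" using assms finite_subset by auto
  then have "binomial_pmf (card A) (1/2)
      = map_pmf (\<lambda>f. card {x\<in>A. f x}) (Pi_pmf A False (\<lambda>_. bernoulli_pmf (1/2)))"
    by (intro binomial_pmf_altdef') auto
  also have "\<dots> = map_pmf (\<lambda>f. card ({x\<in>N. f x} \<inter> A)) (Pi_pmf N False (\<lambda>_. bernoulli_pmf (1/2)))"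
    unfolding Pi_pmf_subset[OF assms] map_pmf_comp
    using assms(2) by (intro map_pmf_cong refl arg_cong[where f = card]) auto
  also have "\<dots> = map_pmf (\<lambda>S. card (S \<inter> A)) (pmf_of_set (Pow N))"
    unfolding pmf_of_set_Pow_conv_bernoulli[OF assms(1), of False, symmetric] map_pmf_comp ..
  finally show ?thesis ..
qed

text \<open>Hoeffding's inequality for the binomial count, at deviation
  \<open>\<eta> * k / 2\<close> from its mean \<open>k / 2\<close>.\<close>

lemma uniform_subset_concentration:
  assumes "A \<subseteq> players n" "card A = k" "0 < k" "0 \<le> \<eta>"
  shows "measure_pmf.prob (uniform_subsets n)
           {S. real (card (S \<inter> A)) \<notin> {(1 - \<eta>) * k / 2..(1 + \<eta>) * k / 2}}
         \<le> 2 * exp (- \<eta>\<^sup>2 * k / 2)"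
proof -
  interpret binomial_distribution k "1/2" by unfold_locales auto
  let ?X = "{x. \<bar>real x - k * (1/2)\<bar> \<ge> \<eta> * k / 2}"
  have "measure_pmf.prob (uniform_subsets n)
      {S. real (card (S \<inter> A)) \<notin> {(1 - \<eta>) * k / 2..(1 + \<eta>) * k / 2}}
    \<le> measure_pmf.prob (uniform_subsets n) ((\<lambda>S. card (S \<inter> A)) -` ?X)"
    by (intro measure_pmf.finite_measure_mono) (auto simp: abs_if field_simps)
  also have "\<dots> = measure_pmf.prob (binomial_pmf k (1/2)) ?X"
    unfolding uniform_subsets_def measure_map_pmf[symmetric]
    using assms by (simp add: card_Int_uniform_subset)
  also have "\<dots> \<le> 2 * exp (- 2 * (\<eta> * k / 2)\<^sup>2 / k)"
    using assms by (intro prob_abs_ge) auto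
  also have "- 2 * (\<eta> * k / 2)\<^sup>2 / k = - \<eta>\<^sup>2 * k / 2"
    using assms by (simp add: power2_eq_square field_simps)
  finally show ?thesis .
qed

text \<open>Both runs are coupled through the same sampled coalitions; they differ only if one of these
  coalitions separates \<open>C1\<close> from \<open>C2\<close>.\<close>

lemma indistinguishable_costs:
  fixes C1 C2 :: "nat set \<Rightarrow> real" and A :: "(nat set \<times> real) list \<Rightarrow> 'a pmf"
  assumes "E1 \<inter> E2 = {}"
    and "measure_pmf.prob (labelled_samples n m C1 \<bind> A) E1 \<ge> 1 - \<delta>"
    and "measure_pmf.prob (labelled_samples n m C2 \<bind> A) E2 \<ge> 1 - \<delta>"
    and "measure_pmf.prob (uniform_subsets n) {S. C1 S \<noteq> C2 S} \<le> \<beta>"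
  shows "1 - 2 * \<delta> \<le> m * \<beta>"
proof -
  let ?p = "replicate_pmf m (uniform_subsets n)"
  define F where "F C = (\<lambda>xs. A (map (\<lambda>S. (S, C S :: real)) xs))" for C
  have eq: "labelled_samples n m C \<bind> A = ?p \<bind> F C" for C
    by (simp add: labelled_samples_def bind_map_pmf F_def)
  have "1 - \<delta> \<le> measure_pmf.prob (?p \<bind> F C1) E1"
    using assms(2) by (simp add: eq)
  also have "\<dots> \<le> measure_pmf.prob (?p \<bind> F C2) E1 + measure_pmf.prob ?p {xs. F C1 xs \<noteq> F C2 xs}"
    by (rule measure_bind_pmf_le)
  also have "measure_pmf.prob ?p {xs. F C1 xs \<noteq> F C2 xs}
      \<le> measure_pmf.prob ?p {xs. \<exists>S\<in>set xs. S \<in> {S. C1 S \<noteq> C2 S}}"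
    by (intro measure_pmf.finite_measure_mono)
       (auto simp: F_def intro!: arg_cong[where f = A] map_cong)
  also have "\<dots> \<le> m * measure_pmf.prob (uniform_subsets n) {S. C1 S \<noteq> C2 S}"
    by (rule measure_replicate_pmf_le)
  also have "\<dots> \<le> m * \<beta>"
    using assms(4) by (intro mult_left_mono) auto
  \<comment> \<open>By disjointness, landing in \<open>E1\<close> under \<open>C2\<close> is a
    failure for \<open>E2\<close>, which has probability at most \<open>\<delta>\<close>.\<close>
  also have "measure_pmf.prob (?p \<bind> F C2) E1 \<le> measure_pmf.prob (?p \<bind> F C2) (- E2)"
    using assms(1) by (intro measure_pmf.finite_measure_mono) auto
  also have "\<dots> = 1 - measure_pmf.prob (?p \<bind> F C2) E2"
    using measure_pmf.prob_compl[of E2 "?p \<bind> F C2"] by (simp add: Compl_eq_Diff_UNIV)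
  also have "\<dots> \<le> \<delta>" using assms(3) by (simp add: eq)
  finally show ?thesis by simp
qed

section \<open>From incompatible estimates to inapproximability\<close>

text \<open>A common estimate lies above \<open>\<alpha>\<close> times the first value and below the
  second value divided by \<open>\<alpha>\<close>, for each player of \<open>A\<close>. Summing over
  \<open>A\<close> contradicts \<open>gap\<close>, which compares the totals of \<open>A\<close> in
  its two roles.\<close>

lemma good_estimates_swapped_disjoint:
  assumes "A \<subseteq> players n" "B \<subseteq> players n" "A \<inter> B = {}"
    and "1 \<le> r" "0 \<le> l" "0 \<le> h" "0 < \<alpha>" "t \<le> 1" "card A = k" "card B = k"
    and gap: "k + (r - 1) * min (real k) h < \<alpha>\<^sup>2 * (r * k + r * (r - 1) * min (real k) l)"
  shows "{est. good_estimate n \<alpha> t g (two_group_cost r l h A B) est}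
       \<inter> {est. good_estimate n \<alpha> t g (two_group_cost r l h B A) est} = {}"
proof (rule ccontr)
  let ?C1 = "two_group_cost r l h A B" and ?C2 = "two_group_cost r l h B A"
  assume "\<not> ?thesis"
  then obtain est where est: "good_estimate n \<alpha> t g ?C1 est" "good_estimate n \<alpha> t g ?C2 est"
    by blast
  have "\<alpha>\<^sup>2 * shapley n ?C1 i \<le> shapley n ?C2 i" if "i \<in> A" for i
  proof -
    have "t \<le> shapley n ?C1 i" "t \<le> shapley n ?C2 i"
      using shapley_two_group_cost_ge_1[of A B r i n l h] shapley_two_group_cost_ge_1[of B A r i n l h]
        assms that by (auto simp: Int_commute)
    then have "\<alpha> * shapley n ?C1 i \<le> est i" "est i \<le> shapley n ?C2 i / \<alpha>"
      using est assms(1) that by (auto simp: good_estimate_def)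
    then have "\<alpha> * shapley n ?C1 i \<le> shapley n ?C2 i / \<alpha>" by linarith
    then show ?thesis using assms(7) by (simp add: field_simps power2_eq_square)
  qed
  then have "\<alpha>\<^sup>2 * (\<Sum>i\<in>A. shapley n ?C1 i) \<le> (\<Sum>i\<in>A. shapley n ?C2 i)"
    unfolding sum_distrib_left by (intro sum_mono)
  moreover have "(\<Sum>i\<in>A. shapley n ?C1 i) = r * k + r * (r - 1) * min (real k) l"
    using assms by (simp add: sum_shapley_two_group_cost(1))
  moreover have "(\<Sum>i\<in>A. shapley n ?C2 i) = k + (r - 1) * min (real k) h"
    using assms by (subst sum_shapley_two_group_cost(2)) auto
  ultimately show False using gap by simp
qed

text \<open>Exponential concentration beats any polynomial number of samples;
  \<open>2 * real k\<close> stands for the number of players.\<close>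

lemma polynomial_times_exp_lt:
  fixes c K b :: real
  assumes "0 < b"
  shows "\<exists>k>0. c * (2 * real k + K) ^ j * exp (- b * real k) < 1 / 8"
proof -
  have "(\<lambda>k. c * (2 * real k + K) ^ j * exp (- b * real k)) \<longlonglongrightarrow> 0"
    using assms by real_asymp
  then have "\<forall>\<^sub>F k in sequentially. c * (2 * real k + K) ^ j * exp (- b * real k) < 1 / 8"
    by (rule order_tendstoD) simp
  then have "\<forall>\<^sub>F k in sequentially. 0 < k \<and> c * (2 * real k + K) ^ j * exp (- b * real k) < 1 / 8"
    using eventually_gt_at_top by eventually_elim auto
  then show ?thesis by (auto dest!: eventually_happens)
qed

theorem theorem8:
  fixes \<kappa> :: real
  assumes "0 \<le> \<kappa>" and "\<kappa> < 1"
  shows "\<exists>\<C> :: nat \<Rightarrow> (nat set \<Rightarrow> real) set.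
           (\<forall>n. \<forall>C \<in> \<C> n. cost_function n C \<and> monotone_cost n C \<and> submodular n C
                          \<and> has_curvature n \<kappa> C) \<and>
           (\<forall>\<epsilon> > 0. \<not> shapley_approximable (sqrt (1 - \<kappa>) + \<epsilon>) \<C>)"
proof -
  define r where "r = 1 / (1 - \<kappa>)"
  have r: "1 \<le> r" "(1 - \<kappa>) * r = 1" using assms by (auto simp: r_def le_divide_eq_1)
  \<comment> \<open>The thresholds stay free so that one class serves every
    \<open>\<epsilon>\<close>; the window used below depends on \<open>\<epsilon>\<close>.\<close>
  define \<C> where "\<C> n = {two_group_cost r l h A B | l h A B. 0 \<le> l \<and> 0 \<le> h \<and> A \<inter> B = {}}"
    for n :: nat
  have family: "cost_function n C \<and> monotone_cost n C \<and> submodular n C \<and> has_curvature n \<kappa> C"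
    if "C \<in> \<C> n" for n C
    using that assms r(1) unfolding \<C>_def
    by (auto intro!: cost_function_two_group_cost monotone_two_group_cost
        submodular_two_group_cost curvature_two_group_cost r_def)
  have "\<not> shapley_approximable (sqrt (1 - \<kappa>) + \<epsilon>) \<C>" if "0 < \<epsilon>" for \<epsilon>
  proof
    define \<alpha> where "\<alpha> = sqrt (1 - \<kappa>) + \<epsilon>"
    assume "shapley_approximable (sqrt (1 - \<kappa>) + \<epsilon>) \<C>"
    then obtain A :: "nat \<Rightarrow> real \<Rightarrow> (nat set \<times> real) list \<Rightarrow> (nat \<Rightarrow> real) pmf"
      and m t g c j where \<alpha>: "0 < \<alpha>"
      and m: "\<And>n \<delta>. 0 < \<delta> \<Longrightarrow> real (m n \<delta>) \<le> c * (real n + 1 / \<delta> + 1 / (1 - \<alpha>) + 1) ^ j"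
      and t: "\<And>n. t n \<le> 1"
      and alg: "\<And>n C \<delta>. C \<in> \<C> n \<Longrightarrow> 0 < \<delta> \<Longrightarrow>
          measure_pmf.prob (labelled_samples n (m n \<delta>) C \<bind> A n \<delta>)
             {est. good_estimate n \<alpha> (t n) (g n) C est} \<ge> 1 - \<delta>"
      unfolding shapley_approximable_def \<alpha>_def[symmetric] by blast
    \<comment> \<open>Exceeding the square root means \<open>\<alpha>\<^sup>2 * r > 1\<close>; this
      excess pays for the width of the window.\<close>
    have "1 - \<kappa> = (sqrt (1 - \<kappa>))\<^sup>2" using assms by simp
    also have "\<dots> < \<alpha>\<^sup>2"
      using that assms by (intro power_strict_mono) (auto simp: \<alpha>_def)
    finally have "(1 - \<kappa>) * r < \<alpha>\<^sup>2 * r" using r by (intro mult_strict_right_mono) auto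
    define q where "q = \<alpha>\<^sup>2 * r"
    have q: "1 < q" using \<open>(1 - \<kappa>) * r < \<alpha>\<^sup>2 * r\<close> r by (simp add: q_def)
    \<comment> \<open>Chosen as the solution of
      \<open>q * (1 - \<eta>) = 1 + \<eta>\<close>.\<close>
    define \<eta> where "\<eta> = (q - 1) / (q + 1)"
    have \<eta>: "0 < \<eta>" "\<eta> < 1" "\<eta> * (q + 1) = q - 1" using q by (simp_all add: \<eta>_def)
    \<comment> \<open>The \<open>4\<close> is \<open>1 / \<delta>\<close> at
      \<open>\<delta> = 1 / 4\<close>, and \<open>1 / (1 - \<alpha>)\<close> is just a constant (0
      if \<open>\<alpha> = 1\<close>). The rate \<open>\<eta>\<^sup>2 / 2\<close> is that of the
      concentration bound.\<close>
    obtain k where k: "0 < k"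
      "c * (2 * real k + (4 + 1 / (1 - \<alpha>) + 1)) ^ j * exp (- (\<eta>\<^sup>2 / 2) * real k) < 1 / 8"
      using polynomial_times_exp_lt[of "\<eta>\<^sup>2 / 2" c "4 + 1 / (1 - \<alpha>) + 1" j] \<eta>(1) by auto
    define n where "n = 2 * k"
    define l h where "l = (1 - \<eta>) * k / 2" and "h = (1 + \<eta>) * k / 2"
    have lh: "0 \<le> l" "0 \<le> h" "l \<le> k" "h \<le> k"
      using \<eta> mult_right_mono[of \<eta> 1 "real k"] by (auto simp: l_def h_def algebra_simps)
    define P Q where "P = {1..k}" and "Q = {k+1..2*k}"
    have PQ: "P \<subseteq> players n" "Q \<subseteq> players n" "P \<inter> Q = {}" "card P = k" "card Q = k"
      by (auto simp: P_def Q_def n_def players_def)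
    let ?C1 = "two_group_cost r l h P Q" and ?C2 = "two_group_cost r l h Q P"
    \<comment> \<open>This is \<open>gap\<close> divided by \<open>k\<close>. By the choice of
      \<open>\<eta>\<close> the terms in \<open>r - 1\<close> cancel, and the difference is exactly
      \<open>q - 1\<close>.\<close>
    have "(1 + (r - 1) * (1 + \<eta>) / 2) < q * (1 + (r - 1) * (1 - \<eta>) / 2)"
    proof -
      have "q * (1 + (r - 1) * (1 - \<eta>) / 2) - (1 + (r - 1) * (1 + \<eta>) / 2)
          = (q - 1) * (1 + (r - 1) / 2) - (r - 1) / 2 * (\<eta> * (q + 1))"
        by (simp add: algebra_simps add_divide_distrib diff_divide_distrib)
      also have "\<dots> = q - 1" unfolding \<eta>(3) by (simp add: algebra_simps)
      finally show ?thesis using q by linarith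
    qed
    then have "(1 + (r - 1) * (1 + \<eta>) / 2) * k < q * (1 + (r - 1) * (1 - \<eta>) / 2) * k"
      using k by simp
    then have gap: "k + (r - 1) * min (real k) h < \<alpha>\<^sup>2 * (r * k + r * (r - 1) * min (real k) l)"
      using lh by (simp add: q_def l_def h_def min_absorb2 algebra_simps)
    define \<beta> where "\<beta> = 4 * exp (- \<eta>\<^sup>2 * k / 2)"
    let ?bad = "\<lambda>X. {S. real (card (S \<inter> X)) \<notin> {l..h}}"
    \<comment> \<open>A coalition can tell the games apart only if one of its two counts leaves the
      window.\<close>
    have "measure_pmf.prob (uniform_subsets n) {S. ?C1 S \<noteq> ?C2 S}
        \<le> measure_pmf.prob (uniform_subsets n) (?bad P \<union> ?bad Q)"
      by (intro measure_pmf.finite_measure_mono) (auto intro!: two_group_cost_swap simp del: atLeastAtMost_iff)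
    also have "\<dots> \<le> measure_pmf.prob (uniform_subsets n) (?bad P)
        + measure_pmf.prob (uniform_subsets n) (?bad Q)"
      by (intro measure_Un_le) auto
    also have "\<dots> \<le> 2 * exp (- \<eta>\<^sup>2 * k / 2) + 2 * exp (- \<eta>\<^sup>2 * k / 2)"
      unfolding l_def h_def
      using PQ k \<eta> by (intro add_mono uniform_subset_concentration) auto
    finally have \<beta>: "measure_pmf.prob (uniform_subsets n) {S. ?C1 S \<noteq> ?C2 S} \<le> \<beta>"
      by (simp add: \<beta>_def)
    have "?C1 \<in> \<C> n" "?C2 \<in> \<C> n" unfolding \<C>_def using lh PQ by blast+
    \<comment> \<open>The left side is \<open>1 / 2\<close>, while the right side will be bounded by
      4 times a quantity below \<open>1 / 8\<close>.\<close>
    then have "1 - 2 * (1 / 4) \<le> m n (1 / 4) * \<beta>"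
      by (intro indistinguishable_costs[where A = "A n (1 / 4)", OF _ alg alg \<beta>]
          good_estimates_swapped_disjoint[where k = k] PQ r(1) lh(1,2) \<alpha> t gap) auto
    also have "\<dots> \<le> c * (real n + 1 / (1 / 4) + 1 / (1 - \<alpha>) + 1) ^ j * \<beta>"
      by (intro mult_right_mono m) (auto simp: \<beta>_def)
    also have "\<dots> = 4 * (c * (2 * real k + (4 + 1 / (1 - \<alpha>) + 1)) ^ j * exp (- (\<eta>\<^sup>2 / 2) * real k))"
      by (simp add: \<beta>_def n_def add.assoc)
    finally show False using k(2) by simp
  qed
  with family show ?thesis by blast
qed

end
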